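(* For linear continuous interpolation, if $u\in C^3(D)$ with $u_{xxx}$ bounded, then for the linearized peridynamic force $$\sup_{i\in K}\big|-\nabla PD_l^\epsilon(\mathcal{I}_h[u])(x_i)-\mathbb{C}u_{xx}(x_i)\big|=O(\epsilon)+O(h/\epsilon),$$ and for the nonlinear peridynamic force $$\sup_{i\in K}\big|-\nabla PD^\epsilon(\mathcal{I}_h[u])(x_i)-\mathbb{C}u_{xx}(x_i)\big|=O(\epsilon)+O(h/\epsilon).$$ Here $O(\epsilon)+O(h/\epsilon)$ means bounded by $C(\epsilon+h/\epsilon)$ with $C$ independent of $h$, $\epsilon$ and $i$.
   Context: $D=[a,b]\subset\mathbb{R}$ is a bounded interval, $\epsilon>0$ is the horizon, and $\partial D^\epsilon=(a-\epsilon,a+\epsilon)\cup(b-\epsilon,b+\epsilon)$ is the nonlocal boundary. $C^n(D)$ is the space of functions with $n$ continuous derivatives on $D$. In this setting, nonlocal displacements have zero boundary values on $\partial D^\epsilon$, and the local elastodynamic displacement is extended by zero outside $D$. The strain is $S(y,x;u)=\frac{u(y)-u(x)}{|y-x|}$. The function $f:[0,\infty)\to\mathbb{R}$ is positive (for $r>0$), smooth and concave with $\lim_{r\to0^+}f(r)/r=f'(0)$ and $\lim_{r\to\infty}f(r)=f_\infty<\infty$, and $f'',f''',f''''$ are bounded on $(0,\infty)$. The influence function $J(|\xi|)$ is zero for $\xi$ outside $[-1,1]$ and satisfies $0\le J(|\xi|)\le M$ on $[-1,1]$. The nonlinear and linearized peridynamic forces are $$-\nabla PD^\epsilon(u)(x)=\frac{2}{\epsilon^2}\int_{x-\epsilon}^{x+\epsilon}J(|y-x|/\epsilon)f'\big(|y-x|S(y,x;u)^2\big)S(y,x;u)\,dy,$$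 $$-\nabla PD_l^\epsilon(u)(x)=\frac{2}{\epsilon^2}\int_{x-\epsilon}^{x+\epsilon}J(|y-x|/\epsilon)f'(0)S(y,x;u)\,dy ,$$ and $\mathbb{C}=\int_{-1}^1J(|z|)f'(0)|z|\,dz$. Mesh: $h>0$ is the mesh size, $x_i=ih$, $K=\{i\in\mathbb{Z}:ih\in\overline D\}$, $K_\epsilon=\{i\in\mathbb{Z}:ih\in\overline{\partial D^\epsilon}\}$; $\overline D$ and $\overline{\partial D^\epsilon}$ contain an integral number of mesh elements and $\epsilon=mh$ with $m$ a positive integer (both $\epsilon$ and $h$ may decrease). For a function $g:\overline{D\cup\partial D^\epsilon}\to\mathbb{R}$ the interpolation operator is $\mathcal{I}_h[g](y)=\sum_{i\in K\cup K_\epsilon}g(x_i)\phi_i(y)$, where $\phi_i$ is the piecewise linear hat function: $\phi_i=0$ outside $[x_{i-1},x_{i+1}]$, $\phi_i(x)=(x-x_{i-1})/h$ on $[x_{i-1},x_i]$, $\phi_i(x)=(x_{i+1}-x)/h$ on $[x_i,x_{i+1}]$.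
   Formalization: The extension of u by zero outside D is additionally assumed to be twice continuously differentiable on the real line (u, u_x, u_xx vanish at a and b); without this the estimate fails at the boundary nodes, e.g. for u = x(1-x) on [0,1]. *)

theory Defs
  imports "HOL-Analysis.Analysis"
begin

(* Derivatives are taken within S, i.e. one-sided at endpoints contained in S. They are meaningful
   for sets S without isolated points, such as nondegenerate intervals. *)

fun nth_deriv_on :: "real set \<Rightarrow> nat \<Rightarrow> (real \<Rightarrow> real) \<Rightarrow> real \<Rightarrow> real" where
  "nth_deriv_on S 0 f = f"
| "nth_deriv_on S (Suc n) f = (\<lambda>x. vector_derivative (nth_deriv_on S n f) (at x within S))"

definition C_on :: "nat \<Rightarrow> real set \<Rightarrow> (real \<Rightarrow> real) \<Rightarrow> bool" where
  "C_on n S f \<longleftrightarrow>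
     (\<forall>k<n. \<forall>x\<in>S. nth_deriv_on S k f differentiable (at x within S)) \<and>
     continuous_on S (nth_deriv_on S n f)"

definition zero_ext :: "real set \<Rightarrow> (real \<Rightarrow> real) \<Rightarrow> real \<Rightarrow> real" where
  "zero_ext D u = (\<lambda>x. if x \<in> D then u x else 0)"

definition strain :: "(real \<Rightarrow> real) \<Rightarrow> real \<Rightarrow> real \<Rightarrow> real" where
  "strain u y x = (u y - u x) / \<bar>y - x\<bar>"

(* The two forces below are the quantities -grad PD and -grad PD_l: the minus sign is included.
   The derivative of the potential f, which lives on the half-line, is the one within {0..}. *)

definition peri_force ::
    "(real \<Rightarrow> real) \<Rightarrow> (real \<Rightarrow> real) \<Rightarrow> real \<Rightarrow> (real \<Rightarrow> real) \<Rightarrow> real \<Rightarrow> real" where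
  "peri_force f J \<epsilon> u x =
     2 / \<epsilon>\<^sup>2 * integral {x - \<epsilon>..x + \<epsilon>}
       (\<lambda>y. J (\<bar>y - x\<bar> / \<epsilon>) * nth_deriv_on {0..} 1 f (\<bar>y - x\<bar> * (strain u y x)\<^sup>2) * strain u y x)"

definition lin_peri_force ::
    "(real \<Rightarrow> real) \<Rightarrow> (real \<Rightarrow> real) \<Rightarrow> real \<Rightarrow> (real \<Rightarrow> real) \<Rightarrow> real \<Rightarrow> real" where
  "lin_peri_force f J \<epsilon> u x =
     2 / \<epsilon>\<^sup>2 * integral {x - \<epsilon>..x + \<epsilon>}
       (\<lambda>y. J (\<bar>y - x\<bar> / \<epsilon>) * nth_deriv_on {0..} 1 f 0 * strain u y x)"

definition elastic_const :: "(real \<Rightarrow> real) \<Rightarrow> (real \<Rightarrow> real) \<Rightarrow> real" where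
  "elastic_const f J = integral {-1..1} (\<lambda>z. J \<bar>z\<bar> * nth_deriv_on {0..} 1 f 0 * \<bar>z\<bar>)"

definition nonlocal_bdry :: "real \<Rightarrow> real \<Rightarrow> real \<Rightarrow> real set" where
  "nonlocal_bdry a b \<epsilon> = {a - \<epsilon><..<a + \<epsilon>} \<union> {b - \<epsilon><..<b + \<epsilon>}"

definition node :: "real \<Rightarrow> int \<Rightarrow> real" where
  "node h i = of_int i * h"

definition nodes_in :: "real \<Rightarrow> real set \<Rightarrow> int set" where
  "nodes_in h A = {i. node h i \<in> closure A}"

definition hat :: "real \<Rightarrow> int \<Rightarrow> real \<Rightarrow> real" where
  "hat h i x =
     (if x \<in> {node h (i - 1)..node h i} then (x - node h (i - 1)) / h
      else if x \<in> {node h i..node h (i + 1)} then (node h (i + 1) - x) / h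
      else 0)"

definition interp :: "real \<Rightarrow> real \<Rightarrow> real \<Rightarrow> real \<Rightarrow> (real \<Rightarrow> real) \<Rightarrow> real \<Rightarrow> real" where
  "interp a b \<epsilon> h g y =
     (\<Sum>i \<in> nodes_in h {a..b} \<union> nodes_in h (nonlocal_bdry a b \<epsilon>). g (node h i) * hat h i y)"

(* A consists of an integral number of mesh elements. *)

definition union_of_elements :: "real \<Rightarrow> real set \<Rightarrow> bool" where
  "union_of_elements h A \<longleftrightarrow> (\<exists>I. finite I \<and> A = (\<Union>i\<in>I. {node h i..node h (i + 1)}))"

definition admissible_mesh :: "real \<Rightarrow> real \<Rightarrow> real \<Rightarrow> real \<Rightarrow> bool" where
  "admissible_mesh a b \<epsilon> h \<longleftrightarrow>
     \<epsilon> > 0 \<and> h > 0 \<and> (\<exists>m::nat. m > 0 \<and> \<epsilon> = of_nat m * h) \<and>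
     union_of_elements h (closure {a..b}) \<and> union_of_elements h (closure (nonlocal_bdry a b \<epsilon>))"

end

theory Submission
  imports Defs
begin

text \<open>
  Let \<open>w\<close> be the zero extension of \<open>u\<close>. It is twice continuously differentiable on the line, with \<open>w'\<close>
  and \<open>w''\<close> bounded and \<open>w''\<close> Lipschitz continuous, because \<open>u'''\<close> is bounded
  (\<open>zero_ext_second_derivative_lipschitz\<close>). Let \<open>g\<close> be its interpolant and \<open>x\<close> a node. Substituting
  \<open>y = x + \<epsilon> z\<close> and pairing the bonds to \<open>x + \<epsilon> z\<close> and \<open>x - \<epsilon> z\<close> turns the force into
  \<open>2 / \<epsilon>\<close> times the integral over \<open>0 \<le> z \<le> 1\<close> of \<open>J z (F (\<rho> s\<^sup>2) s + F (\<rho> t\<^sup>2) t)\<close>, where \<open>\<rho> = \<epsilon> z\<close>, \<open>s\<close> and \<open>t\<close> are the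
  strains of the two bonds, and \<open>F\<close> is \<open>f'\<close> for the nonlinear and the constant \<open>f'(0)\<close> for the
  linearized force (\<open>bond_force_eq_folded_integral\<close>).

  The linear part is \<open>F 0 (s + t)\<close>. Here \<open>s + t\<close> is a second difference of \<open>g\<close> at \<open>x\<close> divided by \<open>\<rho>\<close>. For \<open>w\<close>
  it equals \<open>\<rho> w'' x\<close> up to \<open>O(\<rho>\<^sup>2)\<close>, and integrating \<open>\<rho> w'' x\<close> yields exactly the elastic constant times
  \<open>w'' x\<close>. The interpolation error \<open>g - w\<close> vanishes at nodes and is on each element Lipschitz with
  constant \<open>O(h)\<close>, so it changes \<open>s + t\<close> by \<open>O(h)\<close> uniformly in \<open>\<rho>\<close> (\<open>interp_error_from_node\<close>). With the
  prefactor \<open>2 / \<epsilon>\<close> this gives \<open>O(\<epsilon>) + O(h / \<epsilon>)\<close>.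

  The nonlinear remainder is \<open>(F (\<rho> s\<^sup>2) - F 0) s + (F (\<rho> t\<^sup>2) - F 0) t\<close>. As an odd function summed over two nearly
  opposite arguments it is \<open>O(\<rho> \<bar>s + t\<bar>)\<close> (\<open>odd_nonlinearity_estimate\<close>), hence \<open>O(\<epsilon>\<^sup>2)\<close>, and \<open>O(\<epsilon>)\<close> after
  multiplication with the prefactor. So the nonlinearity costs no accuracy
  (\<open>bond_force_consistency\<close>).
\<close>

section \<open>Integrals of even weights over symmetric intervals\<close>

lemma has_integral_symmetric_interval_fold:
  fixes q :: "real \<Rightarrow> real"
  assumes "0 \<le> c" "q integrable_on {0..c}" "(\<lambda>z. q (- z)) integrable_on {0..c}"
  shows "(q has_integral integral {0..c} (\<lambda>z. q z + q (- z))) {- c..c}"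
proof -
  have "((\<lambda>z. q (- z)) has_integral integral {0..c} (\<lambda>z. q (- z))) {- 0..- (- c)}"
    using assms(3) by (simp add: integrable_integral)
  then have "(q has_integral integral {0..c} (\<lambda>z. q (- z))) {- c..0}"
    by (metis has_integral_reflect_real neg_equal_0_iff_equal)
  then have "(q has_integral integral {0..c} (\<lambda>z. q (- z)) + integral {0..c} q) {- c..c}"
    by (rule has_integral_combine[rotated 2]) (use assms in \<open>auto simp: integrable_integral\<close>)
  then show ?thesis
    by (simp add: integral_add[OF assms(2,3)] add.commute)
qed

text \<open>
  The influence function is merely measurable and bounded, so every integral below is shown to exist
  by domination: a bounded Borel factor keeps the product Lebesgue measurable and bounded.
\<close>

lemma bounded_weight_times_borel_integrable:
  fixes J p :: "real \<Rightarrow> real"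
  assumes J: "J \<in> borel_measurable (lebesgue_on {0..1})"
    and J_bdd: "\<And>z. z \<in> {0..1} \<Longrightarrow> \<bar>J z\<bar> \<le> M"
    and p: "p \<in> borel_measurable borel"
    and p_bdd: "\<And>z. z \<in> {0..1} \<Longrightarrow> \<bar>p z\<bar> \<le> P"
  shows "(\<lambda>z. J z * p z) integrable_on {0..1}"
proof (rule measurable_bounded_by_integrable_imp_integrable_real)
  have "p \<in> borel_measurable (lebesgue_on {0..1})"
    by (intro measurable_restrict_space1 measurable_completion) (use p in simp)
  then show "(\<lambda>z. J z * p z) \<in> borel_measurable (lebesgue_on {0..1})"
    using J by (intro borel_measurable_times)
  show "(\<lambda>_. M * P) integrable_on {0..1::real}"
    by (intro integrable_const_ivl)
  show "\<bar>J z * p z\<bar> \<le> M * P" if "z \<in> {0..1}" for z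
    unfolding abs_mult by (intro mult_mono J_bdd p_bdd that order_trans[OF _ J_bdd[OF that]]) auto
qed auto

section \<open>Bond forces\<close>

text \<open>
  The nonlinear force is the case \<open>F = f'\<close>, the linearized force the case of the constant
  function \<open>F = f'(0)\<close>. Both have the same elastic constant, in which \<open>F\<close> enters through
  \<open>F 0\<close> alone.
\<close>

definition bond_force ::
    "(real \<Rightarrow> real) \<Rightarrow> (real \<Rightarrow> real) \<Rightarrow> real \<Rightarrow> (real \<Rightarrow> real) \<Rightarrow> real \<Rightarrow> real" where
  "bond_force F J \<epsilon> u x =
     2 / \<epsilon>\<^sup>2 * integral {x - \<epsilon>..x + \<epsilon>}
       (\<lambda>y. J (\<bar>y - x\<bar> / \<epsilon>) * F (\<bar>y - x\<bar> * (strain u y x)\<^sup>2) * strain u y x)"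

lemma has_integral_rescale_symmetric:
  fixes q :: "real \<Rightarrow> real"
  assumes "\<epsilon> > 0" "(q has_integral I) {-1..1}"
  shows "((\<lambda>y. q ((y - x) / \<epsilon>)) has_integral \<epsilon> * I) {x - \<epsilon>..x + \<epsilon>}"
proof -
  have "((\<lambda>y. q (1 / \<epsilon> * y + - x / \<epsilon>)) has_integral \<epsilon> * I)
          ((\<lambda>y. \<epsilon> * y + x) ` {-1..1})"
    using has_integral_affinity[of q I "-1" 1 "1 / \<epsilon>" "- x / \<epsilon>"] assms by simp
  moreover have "(\<lambda>y. \<epsilon> * y + x) ` {-1..1} = {x - \<epsilon>..x + \<epsilon>}"
    using assms(1) by (subst image_affinity_atLeastAtMost) (auto simp: algebra_simps)
  ultimately show ?thesis
    by (simp add: diff_divide_distrib)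
qed

text \<open>
  The substitution \<open>y = x + \<epsilon> z\<close> removes one factor \<open>1 / \<epsilon>\<close>. Since the weight is even in \<open>z\<close>, the bonds to
  \<open>x + \<epsilon> z\<close> and \<open>x - \<epsilon> z\<close> can be paired, so that the cancellation of odd terms becomes a pointwise
  statement about the integrand and no integral has to be split into singular parts. A bound on
  the strain makes the integrand bounded.
\<close>

lemma bond_force_eq_folded_integral:
  assumes eps: "\<epsilon> > 0"
    and J: "J \<in> borel_measurable (lebesgue_on {0..1})"
    and J_bdd: "\<And>z. z \<in> {0..1} \<Longrightarrow> \<bar>J z\<bar> \<le> M"
    and F_lip: "\<And>r s. 0 \<le> r \<Longrightarrow> 0 \<le> s \<Longrightarrow> \<bar>F r - F s\<bar> \<le> K * \<bar>r - s\<bar>"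
    and g: "continuous_on UNIV g"
    and g_bdd: "\<And>y. \<bar>strain g y x\<bar> \<le> S"
  defines "p \<equiv> \<lambda>z. F (\<epsilon> * \<bar>z\<bar> * (strain g (x + \<epsilon> * z) x)\<^sup>2) * strain g (x + \<epsilon> * z) x"
  shows "(\<lambda>z. J z * p z) integrable_on {0..1}"
    and "(\<lambda>z. J z * p (- z)) integrable_on {0..1}"
    and "bond_force F J \<epsilon> g x = 2 / \<epsilon> * integral {0..1} (\<lambda>z. J z * (p z + p (- z)))"
proof -
  have K: "0 \<le> K"
    using F_lip[of 0 1] by simp
  have S: "0 \<le> S"
    using g_bdd[of x] by linarith
  have "continuous_on {0..} F"
    by (rule lipschitz_on_continuous_on[where L = K], rule lipschitz_onI)
       (use F_lip K in \<open>auto simp: dist_real_def\<close>)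
  then have "continuous_on UNIV (\<lambda>r. F \<bar>r\<bar>)"
    by (rule continuous_on_compose2) (auto intro!: continuous_intros)
  then have F_meas [measurable]: "(\<lambda>r. F \<bar>r\<bar>) \<in> borel_measurable borel"
    by (rule borel_measurable_continuous_onI)
  have [measurable]: "g \<in> borel_measurable borel"
    using g by (rule borel_measurable_continuous_onI)
  \<comment> \<open>\<open>F\<close> is controlled on the half-line only; its even extension is continuous everywhere.\<close>
  have p_alt: "p = (\<lambda>z. F \<bar>\<epsilon> * \<bar>z\<bar> * (strain g (x + \<epsilon> * z) x)\<^sup>2\<bar> * strain g (x + \<epsilon> * z) x)"
    unfolding p_def using eps by (intro ext) (simp add: abs_mult)
  have p_meas: "p \<in> borel_measurable borel"
    unfolding p_alt strain_def by measurable
  then have p_meas': "(\<lambda>z. p (- z)) \<in> borel_measurable borel"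
    by measurable
  have p_bdd: "\<bar>p z\<bar> \<le> (\<bar>F 0\<bar> + K * (\<epsilon> * S\<^sup>2)) * S" if "\<bar>z\<bar> \<le> 1" for z
  proof -
    define s where "s = strain g (x + \<epsilon> * z) x"
    have s: "\<bar>s\<bar> \<le> S"
      unfolding s_def by (rule g_bdd)
    then have "s\<^sup>2 \<le> S\<^sup>2"
      using abs_le_square_iff by fastforce
    then have r: "\<epsilon> * \<bar>z\<bar> * s\<^sup>2 \<le> \<epsilon> * S\<^sup>2"
      using that eps by (intro mult_mono) (auto simp: mult_le_cancel_left1)
    have r0: "0 \<le> \<epsilon> * \<bar>z\<bar> * s\<^sup>2"
      using eps by simp
    have "\<bar>F (\<epsilon> * \<bar>z\<bar> * s\<^sup>2) - F 0\<bar> \<le> K * (\<epsilon> * \<bar>z\<bar> * s\<^sup>2)"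
      using F_lip[OF r0 order_refl] r0 by simp
    also have "\<dots> \<le> K * (\<epsilon> * S\<^sup>2)"
      using r K by (rule mult_left_mono)
    finally have "\<bar>F (\<epsilon> * \<bar>z\<bar> * s\<^sup>2)\<bar> \<le> \<bar>F 0\<bar> + K * (\<epsilon> * S\<^sup>2)"
      by linarith
    then have "\<bar>F (\<epsilon> * \<bar>z\<bar> * s\<^sup>2) * s\<bar> \<le> (\<bar>F 0\<bar> + K * (\<epsilon> * S\<^sup>2)) * S"
      unfolding abs_mult using s by (intro mult_mono) auto
    then show ?thesis
      unfolding p_def s_def .
  qed
  show int: "(\<lambda>z. J z * p z) integrable_on {0..1}"
    by (rule bounded_weight_times_borel_integrable[OF J J_bdd p_meas p_bdd]) auto
  show int': "(\<lambda>z. J z * p (- z)) integrable_on {0..1}"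
    by (rule bounded_weight_times_borel_integrable[OF J J_bdd p_meas' p_bdd]) auto
  have intabs: "(\<lambda>z. J \<bar>z\<bar> * p z) integrable_on {0..1}"
    using int by (rule integrable_eq) auto
  have intabs': "(\<lambda>z. J \<bar>- z\<bar> * p (- z)) integrable_on {0..1}"
    using int' by (rule integrable_eq) auto
  have "((\<lambda>z. J \<bar>z\<bar> * p z) has_integral
      integral {0..1} (\<lambda>z. J \<bar>z\<bar> * p z + J \<bar>- z\<bar> * p (- z))) {-1..1}"
    using has_integral_symmetric_interval_fold[OF _ intabs intabs'] by simp
  also have "integral {0..1} (\<lambda>z. J \<bar>z\<bar> * p z + J \<bar>- z\<bar> * p (- z))
      = integral {0..1} (\<lambda>z. J z * (p z + p (- z)))" (is "_ = ?I")
    by (intro integral_cong) (auto simp: algebra_simps)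
  finally have "((\<lambda>z. J \<bar>z\<bar> * p z) has_integral ?I) {-1..1}" .
  from has_integral_rescale_symmetric[OF eps this, of x]
  have "((\<lambda>y. J (\<bar>y - x\<bar> / \<epsilon>) * F (\<bar>y - x\<bar> * (strain g y x)\<^sup>2) * strain g y x)
      has_integral \<epsilon> * ?I) {x - \<epsilon>..x + \<epsilon>}"
    using eps by (simp add: p_def abs_divide mult.assoc)
  then show "bond_force F J \<epsilon> g x = 2 / \<epsilon> * ?I"
    unfolding bond_force_def using eps
    by (simp add: integral_unique power2_eq_square)
qed

text \<open>
  The function \<open>s \<mapsto> (F (\<rho> s\<^sup>2) - F 0) s\<close> is odd, so its sum over two opposite bonds is a difference of
  values at \<open>s\<close> and \<open>- t\<close>, which a Lipschitz bound controls by \<open>\<bar>s + t\<bar>\<close>. This gains a factor: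
  bounding the two terms separately would give \<open>\<rho> S\<^sup>3\<close>, which after division by \<open>\<epsilon>\<close> does not tend
  to zero.
\<close>

lemma odd_nonlinearity_estimate:
  fixes F :: "real \<Rightarrow> real"
  assumes F_lip: "\<And>r s. 0 \<le> r \<Longrightarrow> 0 \<le> s \<Longrightarrow> \<bar>F r - F s\<bar> \<le> K * \<bar>r - s\<bar>"
    and \<rho>: "0 \<le> \<rho>" and s: "\<bar>s\<bar> \<le> S" and t: "\<bar>t\<bar> \<le> S"
  shows "\<bar>(F (\<rho> * s\<^sup>2) - F 0) * s + (F (\<rho> * t\<^sup>2) - F 0) * t\<bar> \<le> 3 * K * \<rho> * S\<^sup>2 * \<bar>s + t\<bar>"
proof -
  have K: "0 \<le> K"
    using F_lip[of 0 1] by simp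
  have s2: "s\<^sup>2 \<le> S\<^sup>2"
    using s abs_le_square_iff by fastforce
  have "\<bar>F (\<rho> * s\<^sup>2) - F 0\<bar> \<le> K * (\<rho> * s\<^sup>2)"
    using F_lip[of "\<rho> * s\<^sup>2" 0] \<rho> by simp
  also have "\<dots> \<le> K * (\<rho> * S\<^sup>2)"
    using s2 K \<rho> by (intro mult_left_mono) auto
  finally have 1: "\<bar>(F (\<rho> * s\<^sup>2) - F 0) * (s + t)\<bar> \<le> K * (\<rho> * S\<^sup>2) * \<bar>s + t\<bar>"
    unfolding abs_mult by (rule mult_right_mono) simp
  have "\<bar>F (\<rho> * t\<^sup>2) - F (\<rho> * s\<^sup>2)\<bar> \<le> K * \<bar>\<rho> * t\<^sup>2 - \<rho> * s\<^sup>2\<bar>"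
    using F_lip \<rho> by simp
  also have "\<rho> * t\<^sup>2 - \<rho> * s\<^sup>2 = \<rho> * (t - s) * (s + t)"
    by (simp add: power2_eq_square algebra_simps)
  also have "K * \<bar>\<rho> * (t - s) * (s + t)\<bar> \<le> K * (\<rho> * (2 * S) * \<bar>s + t\<bar>)"
    unfolding abs_mult using K \<rho> s t by (intro mult_left_mono mult_mono) auto
  finally have "\<bar>F (\<rho> * t\<^sup>2) - F (\<rho> * s\<^sup>2)\<bar> \<le> K * (\<rho> * (2 * S) * \<bar>s + t\<bar>)" .
  then have 2: "\<bar>(F (\<rho> * t\<^sup>2) - F (\<rho> * s\<^sup>2)) * t\<bar> \<le> K * (\<rho> * (2 * S) * \<bar>s + t\<bar>) * S"
    unfolding abs_mult using t K \<rho> by (intro mult_mono) auto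
  have "(F (\<rho> * s\<^sup>2) - F 0) * s + (F (\<rho> * t\<^sup>2) - F 0) * t
      = (F (\<rho> * s\<^sup>2) - F 0) * (s + t) + (F (\<rho> * t\<^sup>2) - F (\<rho> * s\<^sup>2)) * t"
    by (simp add: algebra_simps)
  then have "\<bar>(F (\<rho> * s\<^sup>2) - F 0) * s + (F (\<rho> * t\<^sup>2) - F 0) * t\<bar>
      \<le> K * (\<rho> * S\<^sup>2) * \<bar>s + t\<bar> + K * (\<rho> * (2 * S) * \<bar>s + t\<bar>) * S"
    using 1 2 by linarith
  also have "\<dots> = 3 * K * \<rho> * S\<^sup>2 * \<bar>s + t\<bar>"
    by (simp add: power2_eq_square algebra_simps)
  finally show ?thesis .
qed

section \<open>Taylor expansion\<close>

lemma taylor_second_order: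
  fixes w w1 w2 :: "real \<Rightarrow> real"
  assumes w: "\<And>x. (w has_real_derivative w1 x) (at x)"
    and w1: "\<And>x. (w1 has_real_derivative w2 x) (at x)"
  obtains t where "\<bar>t - x\<bar> \<le> \<bar>d\<bar>" "w (x + d) = w x + w1 x * d + w2 t / 2 * d\<^sup>2"
proof (cases "d = 0")
  case True
  then show ?thesis
    using that[of x] by simp
next
  case False
  define D :: "nat \<Rightarrow> real \<Rightarrow> real" where "D m = (if m = 0 then w else if m = 1 then w1 else w2)" for m
  have "\<forall>m t. m < 2 \<and> x - \<bar>d\<bar> \<le> t \<and> t \<le> x + \<bar>d\<bar> \<longrightarrow> DERIV (D m) t :> D (Suc m) t"
    using w w1 by (auto simp: D_def less_2_cases_iff)
  then have "\<exists>t. (if x + d < x then x + d < t \<and> t < x else x < t \<and> t < x + d) \<and>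
      w (x + d) = (\<Sum>m<2. D m x / fact m * (x + d - x) ^ m) + D 2 t / fact 2 * (x + d - x)\<^sup>2"
    by (intro Taylor) (use False in \<open>auto simp: D_def\<close>)
  then obtain t where t: "if x + d < x then x + d < t \<and> t < x else x < t \<and> t < x + d"
    "w (x + d) = (\<Sum>m<2. D m x / fact m * (x + d - x) ^ m) + D 2 t / fact 2 * (x + d - x)\<^sup>2"
    by blast
  have "\<bar>t - x\<bar> \<le> \<bar>d\<bar>"
    using t(1) by (auto split: if_splits)
  moreover have "w (x + d) = w x + w1 x * d + w2 t / 2 * d\<^sup>2"
    using t(2) by (simp add: D_def lessThan_nat_numeral lessThan_Suc)
  ultimately show ?thesis
    by (rule that)
qed

text \<open>
  The sum of the difference quotients of \<open>g\<close> in the two directions is a second difference of \<open>w\<close> divided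
  by \<open>\<rho>\<close>, up to interpolation errors. These stay bounded by \<open>B h\<close> uniformly in \<open>\<rho>\<close> because the error
  is assumed to vanish linearly at \<open>x\<close>; a bound by \<open>h\<^sup>2\<close> alone would be useless for \<open>\<rho>\<close> close to zero.
  The first estimate controls the odd nonlinear remainder, the second one the linear part of the force.
\<close>

lemma second_difference_estimates:
  fixes w w1 w2 g :: "real \<Rightarrow> real"
  assumes w: "\<And>x. (w has_real_derivative w1 x) (at x)"
    and w1: "\<And>x. (w1 has_real_derivative w2 x) (at x)"
    and w2_bdd: "\<And>x. \<bar>w2 x\<bar> \<le> B"
    and w2_lip: "\<And>x y. \<bar>w2 x - w2 y\<bar> \<le> L * \<bar>x - y\<bar>"
    and gx: "g x = w x"
    and g_approx: "\<And>y. \<bar>g y - w y\<bar> \<le> B * h * \<bar>y - x\<bar>"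
    and \<rho>: "0 < \<rho>"
  shows "\<bar>(g (x + \<rho>) - g x) / \<rho> + (g (x - \<rho>) - g x) / \<rho>\<bar> \<le> B * (\<rho> + 2 * h)"
    and "\<bar>(g (x + \<rho>) - g x) / \<rho> + (g (x - \<rho>) - g x) / \<rho> - \<rho> * w2 x\<bar> \<le> L * \<rho>\<^sup>2 + 2 * B * h"
proof -
  obtain t where t: "\<bar>t - x\<bar> \<le> \<bar>\<rho>\<bar>" "w (x + \<rho>) = w x + w1 x * \<rho> + w2 t / 2 * \<rho>\<^sup>2"
    using taylor_second_order[of w w1 w2, OF w w1] by blast
  obtain t' where t': "\<bar>t' - x\<bar> \<le> \<bar>- \<rho>\<bar>"
      "w (x + - \<rho>) = w x + w1 x * (- \<rho>) + w2 t' / 2 * (- \<rho>)\<^sup>2"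
    using taylor_second_order[of w w1 w2, OF w w1] by blast
  define X where "X = (w2 t + w2 t') / 2"
  define e where "e = (g (x + \<rho>) - w (x + \<rho>)) / \<rho>"
  define e' where "e' = (g (x - \<rho>) - w (x - \<rho>)) / \<rho>"
  have e: "\<bar>e\<bar> \<le> B * h" "\<bar>e'\<bar> \<le> B * h"
    using g_approx[of "x + \<rho>"] g_approx[of "x - \<rho>"] \<rho> by (simp_all add: e_def e'_def abs_divide divide_le_eq)
  have "(g (x + \<rho>) - g x) / \<rho> + (g (x - \<rho>) - g x) / \<rho>
      = (w (x + \<rho>) + w (x - \<rho>) - 2 * w x) / \<rho> + e + e'"
    using \<rho> by (simp add: e_def e'_def gx field_simps)
  also have "w (x + \<rho>) + w (x - \<rho>) - 2 * w x = (w2 t + w2 t') / 2 * \<rho>\<^sup>2"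
    using t(2) t'(2) by (simp add: algebra_simps)
  also have "(w2 t + w2 t') / 2 * \<rho>\<^sup>2 / \<rho> = (w2 t + w2 t') / 2 * \<rho>"
    using \<rho> by (simp add: power2_eq_square)
  finally have eq: "(g (x + \<rho>) - g x) / \<rho> + (g (x - \<rho>) - g x) / \<rho> = X * \<rho> + e + e'"
    unfolding X_def .
  have "\<bar>X\<bar> \<le> B"
    using w2_bdd[of t] w2_bdd[of t'] unfolding X_def by (simp add: abs_le_iff)
  then have "\<bar>X * \<rho>\<bar> \<le> B * \<rho>"
    using \<rho> by (simp add: abs_mult)
  then show "\<bar>(g (x + \<rho>) - g x) / \<rho> + (g (x - \<rho>) - g x) / \<rho>\<bar> \<le> B * (\<rho> + 2 * h)"
    unfolding eq using e by (simp add: distrib_left)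
  have L: "0 \<le> L"
    using w2_lip[of 0 1] by simp
  have "\<bar>w2 t - w2 x\<bar> \<le> L * \<rho>" "\<bar>w2 t' - w2 x\<bar> \<le> L * \<rho>"
    using t(1) t'(1) \<rho> L
    by (auto intro!: order_trans[OF w2_lip] mult_left_mono)
  then have "\<bar>X - w2 x\<bar> \<le> L * \<rho>"
    unfolding X_def by (simp add: abs_le_iff field_simps)
  then have "\<bar>(X - w2 x) * \<rho>\<bar> \<le> L * \<rho> * \<rho>"
    using \<rho> by (simp add: abs_mult)
  then show "\<bar>(g (x + \<rho>) - g x) / \<rho> + (g (x - \<rho>) - g x) / \<rho> - \<rho> * w2 x\<bar> \<le> L * \<rho>\<^sup>2 + 2 * B * h"
    unfolding eq using e by (simp add: algebra_simps power2_eq_square)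
qed

section \<open>Piecewise linear interpolation\<close>

lemma hat_eq_max:
  assumes "h > 0"
  shows "hat h i x = max 0 (1 - \<bar>x / h - of_int i\<bar>)"
  using assms unfolding hat_def node_def
  by (auto simp: field_simps abs_if max_def)

lemma continuous_on_interp: "h > 0 \<Longrightarrow> continuous_on UNIV (interp a b \<epsilon> h g)"
  unfolding interp_def hat_eq_max
  by (intro continuous_intros) auto

text \<open>
  It is enough that the index set contains every node at which \<open>g\<close> does not vanish: all other nodes
  contribute zero anyway. Hence the interpolant of a zero extension is the piecewise linear
  interpolant on the whole line, also beyond the nonlocal boundary.
\<close>

lemma hat_sum_on_element:
  assumes h: "h > 0" and N: "finite N"
    and zero: "\<And>i. i \<notin> N \<Longrightarrow> g (node h i) = 0"
    and t: "0 \<le> t" "t \<le> 1"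
  shows "(\<Sum>i\<in>N. g (node h i) * hat h i (node h j + t * h))
    = (1 - t) * g (node h j) + t * g (node h (j + 1))"
proof -
  have hat: "hat h i (node h j + t * h) = max 0 (1 - \<bar>of_int (j - i) + t\<bar>)" for i
    unfolding hat_eq_max[OF h] node_def using h by (simp add: add_divide_distrib)
  have off: "hat h i (node h j + t * h) = 0" if "i \<notin> {j, j + 1}" for i
  proof -
    have "j - i \<ge> 1 \<or> j - i \<le> - 2"
      using that by auto
    then have "(of_int (j - i) :: real) \<ge> 1 \<or> (of_int (j - i) :: real) \<le> - 2"
      by linarith
    then have "1 \<le> \<bar>of_int (j - i) + t\<bar>"
      using t by linarith
    then show ?thesis
      unfolding hat by simp
  qed
  have "(\<Sum>i\<in>N. g (node h i) * hat h i (node h j + t * h))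
      = (\<Sum>i\<in>N \<union> {j, j + 1}. g (node h i) * hat h i (node h j + t * h))"
    by (rule sum.mono_neutral_left) (use N zero in auto)
  also have "\<dots> = (\<Sum>i\<in>{j, j + 1}. g (node h i) * hat h i (node h j + t * h))"
    by (rule sum.mono_neutral_right) (use N off in auto)
  also have "\<dots> = (1 - t) * g (node h j) + t * g (node h (j + 1))"
    using t by (simp add: hat)
  finally show ?thesis .
qed

text \<open>
  The slope of the interpolant on an element is a value of \<open>w1\<close> at an intermediate point, so it differs
  from every other value of \<open>w1\<close> there by at most \<open>B h\<close>. As the error vanishes at both end points, it is
  at most \<open>B h\<close> times the distance to either of them.
\<close>

lemma linear_interpolation_error:
  fixes w w1 :: "real \<Rightarrow> real"
  assumes w: "\<And>x. (w has_real_derivative w1 x) (at x)"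
    and w1_lip: "\<And>x y. \<bar>w1 x - w1 y\<bar> \<le> B * \<bar>x - y\<bar>"
    and h: "0 < h" and t: "0 \<le> t" "t \<le> 1"
  shows "\<bar>(1 - t) * w c + t * w (c + h) - w (c + t * h)\<bar> \<le> B * h * (t * h)"
    and "\<bar>(1 - t) * w c + t * w (c + h) - w (c + t * h)\<bar> \<le> B * h * ((1 - t) * h)"
proof -
  have B: "0 \<le> B"
    using w1_lip[of 0 1] by simp
  have mv: "\<exists>\<xi>\<in>{c..c + h}. w y - w z = (y - z) * w1 \<xi>" if "c \<le> z" "z \<le> y" "y \<le> c + h" for y z
  proof (cases "z = y")
    case True
    then show ?thesis
      using h by (intro bexI[of _ c]) auto
  next
    case False
    then show ?thesis
      using MVT2[of z y w w1] w that by force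
  qed
  have th: "0 \<le> t * h" "t * h \<le> h"
    using t h by (auto simp: mult_le_cancel_right1)
  obtain p where p: "p \<in> {c..c + h}" "w (c + h) - w c = h * w1 p"
    using mv[of c "c + h"] h by auto
  obtain q where q: "q \<in> {c..c + h}" "w (c + t * h) - w c = t * h * w1 q"
    using mv[of c "c + t * h"] th by auto
  obtain r where r: "r \<in> {c..c + h}" "w (c + h) - w (c + t * h) = (1 - t) * h * w1 r"
    using mv[of "c + t * h" "c + h"] th by (auto simp: algebra_simps)
  have lip: "\<bar>w1 y - w1 z\<bar> \<le> B * h" if "y \<in> {c..c + h}" "z \<in> {c..c + h}" for y z
    using that by (intro order_trans[OF w1_lip] mult_left_mono B) auto
  have "(1 - t) * w c + t * w (c + h) - w (c + t * h) = (w1 p - w1 q) * (t * h)"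
  proof -
    have "(1 - t) * w c + t * w (c + h) - w (c + t * h) = t * (w (c + h) - w c) - (w (c + t * h) - w c)"
      by (simp add: algebra_simps)
    then show ?thesis
      unfolding p(2) q(2) by (simp add: algebra_simps)
  qed
  then show "\<bar>(1 - t) * w c + t * w (c + h) - w (c + t * h)\<bar> \<le> B * h * (t * h)"
    using mult_right_mono[OF lip[OF p(1) q(1)] th(1)] t h by (simp add: abs_mult)
  have "(1 - t) * w c + t * w (c + h) - w (c + t * h) = (w1 r - w1 p) * ((1 - t) * h)"
  proof -
    have "(1 - t) * w c + t * w (c + h) - w (c + t * h)
      = (w (c + h) - w (c + t * h)) - (1 - t) * (w (c + h) - w c)"
      by (simp add: algebra_simps)
    then show ?thesis
      unfolding r(2) p(2) by (simp add: algebra_simps)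
  qed
  then show "\<bar>(1 - t) * w c + t * w (c + h) - w (c + t * h)\<bar> \<le> B * h * ((1 - t) * h)"
    using mult_right_mono[OF lip[OF r(1) p(1)], of "(1 - t) * h"] t h by (simp add: abs_mult)
qed

text \<open>
  From any node \<open>k\<close>, an end point of the element of \<open>y\<close> lies between the node and \<open>y\<close>; the error of the
  interpolant is bounded by \<open>B h\<close> times the distance to that end point.
\<close>

lemma interp_error_from_node:
  fixes w w1 :: "real \<Rightarrow> real"
  assumes w: "\<And>x. (w has_real_derivative w1 x) (at x)"
    and w1_lip: "\<And>x y. \<bar>w1 x - w1 y\<bar> \<le> B * \<bar>x - y\<bar>"
    and h: "0 < h"
    and fin: "finite (nodes_in h {a..b} \<union> nodes_in h (nonlocal_bdry a b \<epsilon>))"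
    and supp: "\<And>x. x \<notin> {a..b} \<Longrightarrow> w x = 0"
  shows "\<bar>interp a b \<epsilon> h w y - w y\<bar> \<le> B * h * \<bar>y - node h k\<bar>"
proof -
  have B: "0 \<le> B"
    using w1_lip[of 0 1] by simp
  define j where "j = \<lfloor>y / h\<rfloor>"
  define t where "t = frac (y / h)"
  have t: "0 \<le> t" "t \<le> 1"
    using frac_lt_1[of "y / h"] by (auto simp: t_def)
  have "of_int j + t = y / h"
    by (simp add: j_def t_def frac_def)
  then have y: "y = node h j + t * h"
    using h by (simp add: node_def field_simps)
  have j1: "node h (j + 1) = node h j + h"
    by (simp add: node_def algebra_simps)
  have "w (node h i) = 0" if "i \<notin> nodes_in h {a..b} \<union> nodes_in h (nonlocal_bdry a b \<epsilon>)" for i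
    using that by (intro supp) (simp add: nodes_in_def)
  with hat_sum_on_element[where g = w and j = j, OF h fin _ t]
  have eq: "interp a b \<epsilon> h w y = (1 - t) * w (node h j) + t * w (node h j + h)"
    unfolding interp_def y j1 by blast
  note err = linear_interpolation_error[where w = w and B = B and c = "node h j", OF w w1_lip h t]
  show ?thesis
  proof (cases "k \<le> j")
    case True
    then have "node h k \<le> node h j"
      using h by (simp add: node_def)
    then have "t * h \<le> \<bar>y - node h k\<bar>"
      unfolding y by linarith
    then have "B * h * (t * h) \<le> B * h * \<bar>y - node h k\<bar>"
      using B h by (intro mult_left_mono) auto
    then show ?thesis
      using err(1) unfolding eq unfolding y by linarith
  next
    case False
    then have "j + 1 \<le> k"
      by simp
    then have "node h (j + 1) \<le> node h k"
      using h unfolding node_def by (intro mult_right_mono) auto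
    then have "(1 - t) * h \<le> \<bar>y - node h k\<bar>"
      unfolding y j1 by (simp add: left_diff_distrib)
    then have "B * h * ((1 - t) * h) \<le> B * h * \<bar>y - node h k\<bar>"
      using B h by (intro mult_left_mono) auto
    then show ?thesis
      using err(2) unfolding eq unfolding y by linarith
  qed
qed

text \<open>
  A bounded interval that is a union of elements contains at least one of them. This gives a node in
  the interval, without which the supremum over the nodes would be unspecified, and an upper bound
  for \<open>h\<close>, which makes the strain of the interpolant bounded uniformly over all meshes.
\<close>

lemma admissible_meshD:
  assumes "admissible_mesh a b \<epsilon> h" and "a < b"
  shows "0 < h" "h \<le> \<epsilon>" "h \<le> b - a" "nodes_in h {a..b} \<noteq> {}"
    and "finite (nodes_in h {a..b} \<union> nodes_in h (nonlocal_bdry a b \<epsilon>))"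
proof -
  show h: "0 < h"
    using assms(1) by (simp add: admissible_mesh_def)
  obtain m :: nat where m: "m > 0" "\<epsilon> = of_nat m * h"
    using assms(1) by (auto simp: admissible_mesh_def)
  show eps: "h \<le> \<epsilon>"
    unfolding m(2) using m(1) h by (simp add: mult_le_cancel_right1)
  obtain I where I: "{a..b} = (\<Union>i\<in>I. {node h i..node h (i + 1)})"
    using assms(1) by (auto simp: admissible_mesh_def union_of_elements_def)
  have "{a..b} \<noteq> {}"
    using assms(2) by simp
  then obtain i where "i \<in> I"
    unfolding I by blast
  then have sub: "{node h i..node h (i + 1)} \<subseteq> {a..b}"
    unfolding I by blast
  have "node h (i + 1) = node h i + h"
    by (simp add: node_def algebra_simps)
  then show "h \<le> b - a"
    using sub h by auto
  have "node h i \<in> {a..b}"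
    using sub h by (auto simp: node_def algebra_simps)
  then show "nodes_in h {a..b} \<noteq> {}"
    by (auto simp: nodes_in_def)
  have "closure (nonlocal_bdry a b \<epsilon>) \<subseteq> {a - \<epsilon>..b + \<epsilon>}"
    using assms(2) by (intro closure_minimal) (auto simp: nonlocal_bdry_def)
  then have "nodes_in h {a..b} \<union> nodes_in h (nonlocal_bdry a b \<epsilon>)
      \<subseteq> {\<lfloor>(a - \<epsilon>) / h\<rfloor>..\<lceil>(b + \<epsilon>) / h\<rceil>}"
    using eps h by (fastforce simp: nodes_in_def node_def floor_le_iff le_ceiling_iff field_simps)
  then show "finite (nodes_in h {a..b} \<union> nodes_in h (nonlocal_bdry a b \<epsilon>))"
    by (rule finite_subset) simp
qed

section \<open>Consistency of bond forces\<close>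

text \<open>
  After pairing opposite bonds, the integrand of the error splits into the linear part, where the second
  difference is compared with \<open>\<rho> w''\<close>, and the odd nonlinear remainder. With \<open>\<rho> = \<epsilon> z\<close> and the prefactor
  \<open>2 / \<epsilon>\<close>, the linear part contributes \<open>O(\<epsilon>)\<close> from the Taylor remainder and \<open>O(h / \<epsilon>)\<close> from interpolation,
  and the nonlinear remainder \<open>O(\<epsilon>)\<close>, where \<open>h \<le> \<epsilon>\<close> is used to absorb the interpolation error
  in \<open>s + t\<close>.
\<close>

lemma bond_force_consistency:
  fixes w w1 w2 g F J :: "real \<Rightarrow> real"
  assumes w: "\<And>x. (w has_real_derivative w1 x) (at x)"
    and w1: "\<And>x. (w1 has_real_derivative w2 x) (at x)"
    and w1_bdd: "\<And>x. \<bar>w1 x\<bar> \<le> G"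
    and w2_bdd: "\<And>x. \<bar>w2 x\<bar> \<le> B"
    and w2_lip: "\<And>x y. \<bar>w2 x - w2 y\<bar> \<le> L * \<bar>x - y\<bar>"
    and F_lip: "\<And>r s. 0 \<le> r \<Longrightarrow> 0 \<le> s \<Longrightarrow> \<bar>F r - F s\<bar> \<le> K * \<bar>r - s\<bar>"
    and J: "J \<in> borel_measurable (lebesgue_on {0..1})"
    and J_bdd: "\<And>z. z \<in> {0..1} \<Longrightarrow> \<bar>J z\<bar> \<le> M"
    and g: "continuous_on UNIV g" "g x = w x"
    and g_approx: "\<And>y. \<bar>g y - w y\<bar> \<le> B * h * \<bar>y - x\<bar>"
    and h: "0 < h" "h \<le> \<epsilon>" "h \<le> H"
  shows "\<bar>bond_force F J \<epsilon> g x - integral {-1..1} (\<lambda>z. J \<bar>z\<bar> * F 0 * \<bar>z\<bar>) * w2 x\<bar>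
    \<le> M * (\<bar>F 0\<bar> * (4 * B + 2 * L) + 18 * K * B * (G + B * H)\<^sup>2) * (\<epsilon> + h / \<epsilon>)"
proof -
  have eps: "0 < \<epsilon>"
    using h by simp
  have B: "0 \<le> B"
    using w2_bdd[of 0] by linarith
  have L: "0 \<le> L"
    using w2_lip[of 0 1] by simp
  have K: "0 \<le> K"
    using F_lip[of 0 1] by simp
  have M: "0 \<le> M"
    using J_bdd[of 0] by simp
  define S where "S = G + B * H"
  have w_lip: "\<bar>w y - w z\<bar> \<le> G * \<bar>y - z\<bar>" for y z
    using field_differentiable_bound[of UNIV w w1 G y z] w w1_bdd by simp
  have strain_bdd: "\<bar>strain g y x\<bar> \<le> S" for y
  proof -
    have "\<bar>g y - g x\<bar> \<le> (G + B * h) * \<bar>y - x\<bar>"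
      using g_approx[of y] w_lip[of y x] g(2) by (simp add: distrib_right abs_le_iff)
    moreover have "B * h \<le> B * H"
      using h B by (intro mult_left_mono)
    ultimately have "\<bar>g y - g x\<bar> \<le> S * \<bar>y - x\<bar>"
      unfolding S_def by (elim order_trans) (intro mult_right_mono, auto)
    moreover have "0 \<le> S"
      using w1_bdd[of 0] B h unfolding S_def by (auto intro!: add_nonneg_nonneg mult_nonneg_nonneg)
    ultimately show ?thesis
      by (cases "y = x") (auto simp: strain_def abs_divide divide_le_eq)
  qed
  define p where "p = (\<lambda>z. F (\<epsilon> * \<bar>z\<bar> * (strain g (x + \<epsilon> * z) x)\<^sup>2) * strain g (x + \<epsilon> * z) x)"
  note fold = bond_force_eq_folded_integral[OF eps J J_bdd F_lip g(1) strain_bdd]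
  have fold1: "(\<lambda>z. J z * p z) integrable_on {0..1}"
    unfolding p_def by (rule fold(1))
  have fold2: "(\<lambda>z. J z * p (- z)) integrable_on {0..1}"
    unfolding p_def by (rule fold(2))
  have fold3: "bond_force F J \<epsilon> g x = 2 / \<epsilon> * integral {0..1} (\<lambda>z. J z * (p z + p (- z)))"
    unfolding p_def by (rule fold(3))
  have int_p: "(\<lambda>z. J z * (p z + p (- z))) integrable_on {0..1}"
    using integrable_add[OF fold1 fold2] by (simp add: distrib_left)
  have int_z: "(\<lambda>z. J z * z) integrable_on {0..1}"
    by (rule bounded_weight_times_borel_integrable[OF J J_bdd, where P = 1]) auto
  have int_z1: "(\<lambda>z. J \<bar>z\<bar> * F 0 * \<bar>z\<bar>) integrable_on {0..1}"
    by (rule integrable_eq[OF integrable_on_mult_right[OF int_z, of "F 0"]]) auto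
  have "integral {-1..1} (\<lambda>z. J \<bar>z\<bar> * F 0 * \<bar>z\<bar>)
      = integral {0..1} (\<lambda>z. J \<bar>z\<bar> * F 0 * \<bar>z\<bar> + J \<bar>- z\<bar> * F 0 * \<bar>- z\<bar>)"
    by (intro integral_unique has_integral_symmetric_interval_fold) (use int_z1 in auto)
  also have "\<dots> = integral {0..1} (\<lambda>z. (2 * F 0) * (J z * z))"
    by (intro integral_cong) auto
  finally have elastic: "integral {-1..1} (\<lambda>z. J \<bar>z\<bar> * F 0 * \<bar>z\<bar>)
      = 2 * F 0 * integral {0..1} (\<lambda>z. J z * z)"
    by simp
  define q where "q z = 2 / \<epsilon> * (p z + p (- z)) - 2 * F 0 * w2 x * z" for z
  have "((\<lambda>z. 2 / \<epsilon> * (J z * (p z + p (- z))) - 2 * F 0 * w2 x * (J z * z)) has_integral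
      2 / \<epsilon> * integral {0..1} (\<lambda>z. J z * (p z + p (- z)))
        - 2 * F 0 * w2 x * integral {0..1} (\<lambda>z. J z * z)) {0..1}"
    by (intro has_integral_diff has_integral_mult_right integrable_integral int_p int_z)
  then have has_int: "((\<lambda>z. J z * q z) has_integral
      bond_force F J \<epsilon> g x - integral {-1..1} (\<lambda>z. J \<bar>z\<bar> * F 0 * \<bar>z\<bar>) * w2 x) (cbox 0 1)"
    unfolding q_def fold3 elastic by (simp add: algebra_simps)
  define E where "E = (\<bar>F 0\<bar> * (4 * B + 2 * L) + 18 * K * B * S\<^sup>2) * (\<epsilon> + h / \<epsilon>)"
  have E: "0 \<le> E"
    unfolding E_def using B L K eps h by (intro mult_nonneg_nonneg add_nonneg_nonneg) auto
  have q_bdd: "\<bar>q z\<bar> \<le> E" if z: "z \<in> {0..1}" for z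
  proof (cases "z = 0")
    case True
    \<comment> \<open>The strain of a bond of length zero is a division by zero, hence zero.\<close>
    then have "q z = 0"
      by (simp add: q_def p_def strain_def)
    then show ?thesis
      using E by simp
  next
    case False
    define \<rho> where "\<rho> = \<epsilon> * z"
    have \<rho>: "0 < \<rho>" "\<rho> \<le> \<epsilon>"
      using z False eps by (auto simp: \<rho>_def mult_le_cancel_left2)
    define s where "s = (g (x + \<rho>) - g x) / \<rho>"
    define t where "t = (g (x - \<rho>) - g x) / \<rho>"
    have st: "s = strain g (x + \<rho>) x" "t = strain g (x - \<rho>) x"
      using \<rho> by (simp_all add: s_def t_def strain_def)
    have bdd: "\<bar>s\<bar> \<le> S" "\<bar>t\<bar> \<le> S"
      unfolding st by (rule strain_bdd)+
    note diff = second_difference_estimates[OF w w1 w2_bdd w2_lip g(2) g_approx \<rho>(1),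
        folded s_def t_def]
    have p: "p z = F (\<rho> * s\<^sup>2) * s" "p (- z) = F (\<rho> * t\<^sup>2) * t"
      using z by (simp_all add: p_def st \<rho>_def)
    define R where "R = (F (\<rho> * s\<^sup>2) - F 0) * s + (F (\<rho> * t\<^sup>2) - F 0) * t"
    have st_le: "\<bar>s + t\<bar> \<le> 3 * B * \<epsilon>"
    proof -
      have "B * (\<rho> + 2 * h) \<le> B * (3 * \<epsilon>)"
        using \<rho> h B by (intro mult_left_mono) auto
      then show ?thesis
        using diff(1) by simp
    qed
    have "\<bar>R\<bar> \<le> 3 * K * \<rho> * S\<^sup>2 * \<bar>s + t\<bar>"
      unfolding R_def using \<rho> by (intro odd_nonlinearity_estimate F_lip bdd) auto
    also have "\<dots> \<le> 3 * K * \<epsilon> * S\<^sup>2 * (3 * B * \<epsilon>)"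
      using \<rho> K B eps st_le by (intro mult_mono) auto
    finally have "2 / \<epsilon> * \<bar>R\<bar> \<le> 2 / \<epsilon> * (3 * K * \<epsilon> * S\<^sup>2 * (3 * B * \<epsilon>))"
      using eps by (intro mult_left_mono) auto
    also have "\<dots> = 18 * K * B * S\<^sup>2 * \<epsilon>"
      using eps by (simp add: field_simps)
    also have "\<dots> \<le> 18 * K * B * S\<^sup>2 * (\<epsilon> + h / \<epsilon>)"
      using K B eps h by (intro mult_left_mono) auto
    finally have R_le: "\<bar>2 / \<epsilon> * R\<bar> \<le> 18 * K * B * S\<^sup>2 * (\<epsilon> + h / \<epsilon>)"
      using eps by (simp add: abs_mult)
    have "\<bar>s + t - \<rho> * w2 x\<bar> \<le> L * \<epsilon>\<^sup>2 + 2 * B * h"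
    proof -
      have "L * \<rho>\<^sup>2 \<le> L * \<epsilon>\<^sup>2"
        using \<rho> L by (intro mult_left_mono power_mono) auto
      then show ?thesis
        using diff(2) by linarith
    qed
    then have "2 / \<epsilon> * \<bar>s + t - \<rho> * w2 x\<bar> \<le> 2 / \<epsilon> * (L * \<epsilon>\<^sup>2 + 2 * B * h)"
      using eps by (intro mult_left_mono) auto
    also have "\<dots> = 2 * L * \<epsilon> + 4 * B * (h / \<epsilon>)"
      using eps by (simp add: field_simps power2_eq_square)
    also have "\<dots> \<le> (4 * B + 2 * L) * (\<epsilon> + h / \<epsilon>)"
    proof -
      have "0 \<le> 4 * B * \<epsilon> + 2 * L * (h / \<epsilon>)"
        using B L eps h by (intro add_nonneg_nonneg mult_nonneg_nonneg) auto
      then show ?thesis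
        by (simp only: distrib_right distrib_left)
    qed
    finally have "\<bar>F 0\<bar> * (2 / \<epsilon> * \<bar>s + t - \<rho> * w2 x\<bar>) \<le> \<bar>F 0\<bar> * ((4 * B + 2 * L) * (\<epsilon> + h / \<epsilon>))"
      by (intro mult_left_mono) auto
    then have lin_le: "\<bar>F 0 * (2 / \<epsilon> * (s + t - \<rho> * w2 x))\<bar> \<le> \<bar>F 0\<bar> * (4 * B + 2 * L) * (\<epsilon> + h / \<epsilon>)"
      using eps by (simp only: abs_mult abs_divide abs_numeral abs_of_pos mult.assoc)
    have "q z = 2 / \<epsilon> * R + F 0 * (2 / \<epsilon> * (s + t - \<rho> * w2 x))"
      unfolding q_def p R_def \<rho>_def using eps by (simp add: field_simps)
    also have "\<bar>\<dots>\<bar> \<le> 18 * K * B * S\<^sup>2 * (\<epsilon> + h / \<epsilon>) + \<bar>F 0\<bar> * (4 * B + 2 * L) * (\<epsilon> + h / \<epsilon>)"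
      by (rule order_trans[OF abs_triangle_ineq add_mono[OF R_le lin_le]])
    also have "\<dots> = E"
      unfolding E_def by (simp only: distrib_right[of _ _ "\<epsilon> + h / \<epsilon>"] add.commute)
    finally show ?thesis .
  qed
  have "norm (J z * q z) \<le> M * E" if "z \<in> cbox 0 1" for z
    unfolding real_norm_def abs_mult using that M by (intro mult_mono J_bdd q_bdd) auto
  from has_integral_bound[OF _ has_int this] show ?thesis
    using M E by (simp add: E_def S_def mult.assoc)
qed

section \<open>Zero extension\<close>

lemma C_on_has_real_derivative:
  assumes "C_on n S f" "k < n" "x \<in> S"
  shows "(nth_deriv_on S k f has_real_derivative nth_deriv_on S (Suc k) f x) (at x within S)"
  using assms unfolding C_on_def
  by (simp add: has_real_derivative_iff_has_vector_derivative vector_derivative_works)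

lemma nth_deriv_on_interval_eq:
  assumes "C_on n UNIV w" and "a < b" and "\<And>x. x \<in> {a..b} \<Longrightarrow> u x = w x"
    and "k \<le> n" "x \<in> {a..b}"
  shows "nth_deriv_on {a..b} k u x = nth_deriv_on UNIV k w x"
  using assms(4,5)
proof (induction k arbitrary: x)
  case 0
  then show ?case
    using assms(3) by simp
next
  case (Suc k)
  have "(nth_deriv_on UNIV k w has_vector_derivative nth_deriv_on UNIV (Suc k) w x) (at x within {a..b})"
    using C_on_has_real_derivative[OF assms(1), of k x] Suc.prems
    by (auto simp: has_real_derivative_iff_has_vector_derivative intro: has_vector_derivative_at_within)
  then have "(nth_deriv_on {a..b} k u has_vector_derivative nth_deriv_on UNIV (Suc k) w x) (at x within {a..b})"
    by (rule has_vector_derivative_transform[rotated 2]) (use Suc in auto)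
  then show ?case
    using Suc.prems assms(2) vector_derivative_within_cbox[of a b x] by simp
qed

text \<open>
  Continuity carries the value zero over to the end points.
\<close>

lemma vanishes_outside_open_interval:
  fixes v :: "real \<Rightarrow> real"
  assumes "continuous_on UNIV v" and "\<And>x. x \<notin> {a..b} \<Longrightarrow> v x = 0" and "x \<notin> {a<..<b}"
  shows "v x = 0"
proof -
  have cl: "closed {x. v x = 0}"
    using assms(1) by (intro closed_Collect_eq) auto
  have "closure {..<a} \<subseteq> {x. v x = 0}" "closure {b<..} \<subseteq> {x. v x = 0}"
    by (rule closure_minimal[OF _ cl]; use assms(2) in auto)+
  then show ?thesis
    using assms(3) by (cases "x \<le> a") (auto simp: not_le not_less)
qed

text \<open>
  Projection onto the interval is nonexpansive, so bounds and Lipschitz constants on the interval carry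
  over to the whole line.
\<close>

lemma eq_at_nearest_point:
  fixes v :: "real \<Rightarrow> real"
  assumes "continuous_on UNIV v" and "\<And>x. x \<notin> {a..b} \<Longrightarrow> v x = 0" and "a < b"
  shows "v x = v (max a (min b x))"
proof (cases "x \<in> {a<..<b}")
  case False
  then have "max a (min b x) \<notin> {a<..<b}"
    by auto
  then show ?thesis
    using False vanishes_outside_open_interval[OF assms(1,2)] by metis
qed auto

lemma nth_deriv_zero_ext_outside:
  assumes "x \<notin> {a..b}"
  shows "nth_deriv_on UNIV k (zero_ext {a..b} u) x = 0"
  using assms
proof (induction k arbitrary: x)
  case 0
  then show ?case
    by (auto simp: zero_ext_def)
next
  case (Suc k)
  have "((\<lambda>_. 0) has_vector_derivative 0) (at x)"
    by simp
  then have "(nth_deriv_on UNIV k (zero_ext {a..b} u) has_vector_derivative 0) (at x)"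
    by (rule has_vector_derivative_transform_within_open[where S = "- {a..b}"])
      (use Suc in \<open>auto intro: closed_real_atLeastAtMost\<close>)
  then show ?case
    by (simp add: vector_derivative_at)
qed

lemma bounded_vanishing_outside_interval:
  fixes v :: "real \<Rightarrow> real"
  assumes "continuous_on UNIV v" and "\<And>x. x \<notin> {a..b} \<Longrightarrow> v x = 0" and "a < b"
  obtains C where "\<And>x. \<bar>v x\<bar> \<le> C"
proof -
  have "compact (v ` {a..b})"
    by (intro compact_continuous_image) (use assms(1) continuous_on_subset in auto)
  then obtain C where C: "\<forall>x\<in>{a..b}. \<bar>v x\<bar> \<le> C"
    by (auto dest!: compact_imp_bounded simp: bounded_iff)
  have "\<bar>v x\<bar> \<le> C" for x
    using eq_at_nearest_point[OF assms, of x] C assms(3) by auto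
  then show ?thesis
    by (rule that)
qed

text \<open>
  The third derivative of the zero extension may jump at the end points, so it cannot be used on the
  whole line. The bound on \<open>u'''\<close> gives a Lipschitz constant on the interval, and this constant is
  inherited by the extension, whose second derivative is continuous.
\<close>

lemma zero_ext_second_derivative_lipschitz:
  assumes "a < b" and u: "C_on 3 {a..b} u"
    and bdd: "bounded (nth_deriv_on {a..b} 3 u ` {a..b})"
    and ext: "C_on 2 UNIV (zero_ext {a..b} u)"
  obtains L where "\<And>x y. \<bar>nth_deriv_on UNIV 2 (zero_ext {a..b} u) x
      - nth_deriv_on UNIV 2 (zero_ext {a..b} u) y\<bar> \<le> L * \<bar>x - y\<bar>"
proof -
  let ?v = "nth_deriv_on UNIV 2 (zero_ext {a..b} u)"
  obtain L where L: "\<And>x. x \<in> {a..b} \<Longrightarrow> \<bar>nth_deriv_on {a..b} 3 u x\<bar> \<le> L"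
    using bdd by (fastforce simp: bounded_iff)
  have "0 \<le> L"
    using L[of a] assms(1) by simp
  have eq: "?v x = nth_deriv_on {a..b} 2 u x" if "x \<in> {a..b}" for x
    using nth_deriv_on_interval_eq[OF ext assms(1) _ order_refl that, of u]
    by (auto simp: zero_ext_def)
  have der: "(nth_deriv_on {a..b} 2 u has_real_derivative nth_deriv_on {a..b} 3 u x) (at x within {a..b})"
    if "x \<in> {a..b}" for x
    using C_on_has_real_derivative[OF u _ that, of 2] by (simp only: eval_nat_numeral)
  have lip: "\<bar>?v x - ?v y\<bar> \<le> L * \<bar>x - y\<bar>" if "x \<in> {a..b}" "y \<in> {a..b}" for x y
    using field_differentiable_bound[OF convex_real_interval(5) der _ that, of L] L that
    unfolding eq[OF that(1)] eq[OF that(2)] by simp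
  have v: "continuous_on UNIV ?v"
    using ext by (simp add: C_on_def)
  have "\<bar>?v x - ?v y\<bar> \<le> L * \<bar>x - y\<bar>" for x y
  proof -
    let ?c = "\<lambda>x. max a (min b x)"
    have "\<bar>?v x - ?v y\<bar> = \<bar>?v (?c x) - ?v (?c y)\<bar>"
      using eq_at_nearest_point[OF v nth_deriv_zero_ext_outside assms(1)] by metis
    also have "\<dots> \<le> L * \<bar>?c x - ?c y\<bar>"
      using assms(1) by (intro lip) auto
    also have "\<dots> \<le> L * \<bar>x - y\<bar>"
      using \<open>0 \<le> L\<close> by (intro mult_left_mono) auto
    finally show ?thesis .
  qed
  then show ?thesis
    by (rule that)
qed

section \<open>Error of the force of the interpolated displacement\<close>

text \<open>
  The bound on \<open>f''\<close> is given on the open half-line only; the value at zero is a single number and is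
  included in the constant.
\<close>

lemma C_on_derivative_lipschitz:
  assumes f: "C_on 2 {0..} f" and bdd: "bounded (nth_deriv_on {0..} 2 f ` {0<..})"
  obtains K where "\<And>r s. 0 \<le> r \<Longrightarrow> 0 \<le> s \<Longrightarrow>
    \<bar>nth_deriv_on {0..} 1 f r - nth_deriv_on {0..} 1 f s\<bar> \<le> K * \<bar>r - s\<bar>"
proof -
  obtain C where C: "\<And>x. x > 0 \<Longrightarrow> \<bar>nth_deriv_on {0..} 2 f x\<bar> \<le> C"
    using bdd by (auto simp: bounded_iff)
  define K where "K = max C \<bar>nth_deriv_on {0..} 2 f 0\<bar>"
  have K: "\<bar>nth_deriv_on {0..} 2 f x\<bar> \<le> K" if "x \<in> {0..}" for x
    using C[of x] that by (cases "x = 0") (auto simp: K_def)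
  have der: "(nth_deriv_on {0..} 1 f has_real_derivative nth_deriv_on {0..} 2 f x) (at x within {0..})"
    if "x \<in> {0..}" for x
    using C_on_has_real_derivative[OF f _ that, of 1] by (simp add: numeral_2_eq_2)
  have "\<bar>nth_deriv_on {0..} 1 f r - nth_deriv_on {0..} 1 f s\<bar> \<le> K * \<bar>r - s\<bar>"
    if "0 \<le> r" "0 \<le> s" for r s
    using field_differentiable_bound[of "{0..}" "nth_deriv_on {0..} 1 f" "nth_deriv_on {0..} 2 f" K r s]
      der K that by simp
  then show ?thesis
    by (rule that)
qed

text \<open>
  The constants \<open>G\<close>, \<open>B\<close>, \<open>L\<close> describe \<open>u\<close> alone and \<open>h \<le> b - a\<close> holds for every mesh, so the constant
  from the consistency estimate does not depend on \<open>h\<close>, \<open>\<epsilon>\<close> or the node.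
\<close>

lemma SUP_interp_force_error_le:
  fixes a b M :: real and F J u :: "real \<Rightarrow> real"
  assumes D: "a < b"
    and F_lip: "\<And>r s. 0 \<le> r \<Longrightarrow> 0 \<le> s \<Longrightarrow> \<bar>F r - F s\<bar> \<le> K * \<bar>r - s\<bar>"
    and J_meas: "J \<in> borel_measurable (lebesgue_on {0..1})"
    and J_bdd: "\<And>z. z \<in> {0..1} \<Longrightarrow> \<bar>J z\<bar> \<le> M"
    and u_C3: "C_on 3 {a..b} u"
    and u_xxx_bdd: "bounded (nth_deriv_on {a..b} 3 u ` {a..b})"
    and u_ext: "C_on 2 UNIV (zero_ext {a..b} u)"
  shows "\<exists>C. \<forall>\<epsilon> h. admissible_mesh a b \<epsilon> h \<longrightarrow>
            (SUP i \<in> nodes_in h {a..b}.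
               \<bar>bond_force F J \<epsilon> (interp a b \<epsilon> h (zero_ext {a..b} u)) (node h i)
                 - integral {-1..1} (\<lambda>z. J \<bar>z\<bar> * F 0 * \<bar>z\<bar>) * nth_deriv_on {a..b} 2 u (node h i)\<bar>)
            \<le> C * (\<epsilon> + h / \<epsilon>)"
proof -
  define w where "w = zero_ext {a..b} u"
  define w1 where "w1 = nth_deriv_on UNIV 1 w"
  define w2 where "w2 = nth_deriv_on UNIV 2 w"
  have w: "(w has_real_derivative w1 x) (at x)" for x
    using C_on_has_real_derivative[OF u_ext, of 0 x] by (simp add: w1_def w_def)
  have w1: "(w1 has_real_derivative w2 x) (at x)" for x
    using C_on_has_real_derivative[OF u_ext, of 1 x] by (simp add: w1_def w2_def w_def numeral_2_eq_2)
  have out: "w1 x = 0" "w2 x = 0" if "x \<notin> {a..b}" for x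
    using that unfolding w1_def w2_def w_def by (rule nth_deriv_zero_ext_outside)+
  have "continuous_on UNIV w1"
    using w1 by (rule DERIV_continuous_on)
  then obtain G where G: "\<And>x. \<bar>w1 x\<bar> \<le> G"
    using bounded_vanishing_outside_interval[of w1 a b] out(1) D by blast
  have "continuous_on UNIV w2"
    using u_ext by (simp add: C_on_def w2_def w_def)
  then obtain B where B: "\<And>x. \<bar>w2 x\<bar> \<le> B"
    using bounded_vanishing_outside_interval[of w2 a b] out(2) D by blast
  obtain L where L: "\<And>x y. \<bar>w2 x - w2 y\<bar> \<le> L * \<bar>x - y\<bar>"
    using zero_ext_second_derivative_lipschitz[OF D u_C3 u_xxx_bdd u_ext] unfolding w2_def w_def by blast
  have w1_lip: "\<bar>w1 x - w1 y\<bar> \<le> B * \<bar>x - y\<bar>" for x y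
    using field_differentiable_bound[of UNIV w1 w2 B x y] w1 B by simp
  have supp: "w x = 0" if "x \<notin> {a..b}" for x
    using that by (auto simp: w_def zero_ext_def)
  define C where "C = M * (\<bar>F 0\<bar> * (4 * B + 2 * L) + 18 * K * B * (G + B * (b - a))\<^sup>2)"
  have "(SUP i \<in> nodes_in h {a..b}.
      \<bar>bond_force F J \<epsilon> (interp a b \<epsilon> h w) (node h i)
        - integral {-1..1} (\<lambda>z. J \<bar>z\<bar> * F 0 * \<bar>z\<bar>) * nth_deriv_on {a..b} 2 u (node h i)\<bar>)
      \<le> C * (\<epsilon> + h / \<epsilon>)" if mesh: "admissible_mesh a b \<epsilon> h" for \<epsilon> h
  proof (rule cSUP_least)
    note m = admissible_meshD[OF mesh D]
    show "nodes_in h {a..b} \<noteq> {}"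
      by (rule m(4))
    fix i
    assume "i \<in> nodes_in h {a..b}"
    then have i: "node h i \<in> {a..b}"
      by (simp add: nodes_in_def)
    have u2: "nth_deriv_on {a..b} 2 u (node h i) = w2 (node h i)"
      unfolding w2_def w_def
      by (rule nth_deriv_on_interval_eq[OF u_ext D _ order_refl i]) (simp add: zero_ext_def)
    have approx: "\<bar>interp a b \<epsilon> h w y - w y\<bar> \<le> B * h * \<bar>y - node h i\<bar>" for y
      by (rule interp_error_from_node[OF w w1_lip m(1,5) supp])
    have "interp a b \<epsilon> h w (node h i) = w (node h i)"
      using approx[of "node h i"] by simp
    from bond_force_consistency[OF w w1 G B L F_lip J_meas J_bdd
        continuous_on_interp[OF m(1)] this approx m(1-3)]
    show "\<bar>bond_force F J \<epsilon> (interp a b \<epsilon> h w) (node h i)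
        - integral {-1..1} (\<lambda>z. J \<bar>z\<bar> * F 0 * \<bar>z\<bar>) * nth_deriv_on {a..b} 2 u (node h i)\<bar>
      \<le> C * (\<epsilon> + h / \<epsilon>)"
      unfolding C_def u2 .
  qed
  then show ?thesis
    unfolding w_def by blast
qed

theorem proposition3:
  fixes a b M f_inf :: real and f J u :: "real \<Rightarrow> real"
  assumes D: "a < b"
    and f_pos: "\<And>r. r > 0 \<Longrightarrow> f r > 0"
    and f_smooth: "\<And>n. C_on n {0..} f"
    and f_concave: "concave_on {0..} f"
    and f_zero: "((\<lambda>r. f r / r) \<longlongrightarrow> nth_deriv_on {0..} 1 f 0) (at_right 0)"
    and f_infty: "(f \<longlongrightarrow> f_inf) at_top"
    and f_bdd: "bounded (nth_deriv_on {0..} 2 f ` {0<..})"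
               "bounded (nth_deriv_on {0..} 3 f ` {0<..})"
               "bounded (nth_deriv_on {0..} 4 f ` {0<..})"
    and J_meas: "J \<in> borel_measurable (lebesgue_on {0..1})"
    and J_zero: "\<And>\<xi>. \<xi> \<notin> {-1..1} \<Longrightarrow> J \<bar>\<xi>\<bar> = 0"
    and J_bdd: "\<And>\<xi>. \<xi> \<in> {-1..1} \<Longrightarrow> 0 \<le> J \<bar>\<xi>\<bar> \<and> J \<bar>\<xi>\<bar> \<le> M"
    and u_C3: "C_on 3 {a..b} u"
    and u_xxx_bdd: "bounded (nth_deriv_on {a..b} 3 u ` {a..b})"
    and u_ext: "C_on 2 UNIV (zero_ext {a..b} u)"
  shows "(\<exists>C. \<forall>\<epsilon> h. admissible_mesh a b \<epsilon> h \<longrightarrow>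
            (SUP i \<in> nodes_in h {a..b}.
               \<bar>lin_peri_force f J \<epsilon> (interp a b \<epsilon> h (zero_ext {a..b} u)) (node h i)
                 - elastic_const f J * nth_deriv_on {a..b} 2 u (node h i)\<bar>)
            \<le> C * (\<epsilon> + h / \<epsilon>)) \<and>
         (\<exists>C. \<forall>\<epsilon> h. admissible_mesh a b \<epsilon> h \<longrightarrow>
            (SUP i \<in> nodes_in h {a..b}.
               \<bar>peri_force f J \<epsilon> (interp a b \<epsilon> h (zero_ext {a..b} u)) (node h i)
                 - elastic_const f J * nth_deriv_on {a..b} 2 u (node h i)\<bar>)
            \<le> C * (\<epsilon> + h / \<epsilon>))"
proof
  have J_abs: "\<bar>J z\<bar> \<le> M" if "z \<in> {0..1}" for z
    using J_bdd[of z] that by simp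
  obtain K where K: "\<And>r s. 0 \<le> r \<Longrightarrow> 0 \<le> s \<Longrightarrow>
      \<bar>nth_deriv_on {0..} 1 f r - nth_deriv_on {0..} 1 f s\<bar> \<le> K * \<bar>r - s\<bar>"
    using C_on_derivative_lipschitz[OF f_smooth f_bdd(1)] by blast
  note error = SUP_interp_force_error_le[OF D _ J_meas J_abs u_C3 u_xxx_bdd u_ext]
  show "\<exists>C. \<forall>\<epsilon> h. admissible_mesh a b \<epsilon> h \<longrightarrow>
      (SUP i \<in> nodes_in h {a..b}.
         \<bar>lin_peri_force f J \<epsilon> (interp a b \<epsilon> h (zero_ext {a..b} u)) (node h i)
           - elastic_const f J * nth_deriv_on {a..b} 2 u (node h i)\<bar>) \<le> C * (\<epsilon> + h / \<epsilon>)"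
    using error[of "\<lambda>_. nth_deriv_on {0..} 1 f 0" 0]
    unfolding lin_peri_force_def elastic_const_def bond_force_def by simp
  show "\<exists>C. \<forall>\<epsilon> h. admissible_mesh a b \<epsilon> h \<longrightarrow>
      (SUP i \<in> nodes_in h {a..b}.
         \<bar>peri_force f J \<epsilon> (interp a b \<epsilon> h (zero_ext {a..b} u)) (node h i)
           - elastic_const f J * nth_deriv_on {a..b} 2 u (node h i)\<bar>) \<le> C * (\<epsilon> + h / \<epsilon>)"
    using error[of "nth_deriv_on {0..} 1 f" K, OF K]
    unfolding peri_force_def elastic_const_def bond_force_def .
qed

end
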